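(* Let $C\subset\mathbb{R}$ be a compact set, and let $\tau=\tau(C)$ be its thickness. Then $C$ contains a homothetic copy of every set with at most $$N(\tau):=\left\lfloor\frac{\log (4)}{4 e\, (720)^2}\,\frac{\tau}{\log (\tau)}\right\rfloor$$ elements. Moreover, for each such set $A$, the compact set $C$ contains $\lambda A+x$ for some $\lambda>0$ and a set of $x$ of positive Hausdorff dimension.
   Context: A homothetic copy of $A\subset\mathbb{R}$ is a set of the form $\lambda A+x$ with $\lambda>0$, $x\in\mathbb{R}$. $\log$ is the natural logarithm. Thickness: let $C\subset\mathbb{R}$ be a compact set with convex hull $I$. Let $(G_n)_n$ be the (finitely or countably many) disjoint open intervals making up $I\setminus C$, ordered by decreasing length (ties ordered arbitrarily; this does not affect the value below). $G_{n}$ is a subset of a connected component $I_{n}$ (a closed interval) of $I\setminus(G_1\cup\cdots\cup G_{n-1})$, and $I_n\setminus G_n$ consists of two closed intervals, the left piece $L_n$ and the right piece $R_n$. The thickness of $C$ is $$\tau(C):=\inf_n \frac{\min\{|L_n|,|R_n|\}}{|G_n|},$$ where $|J|$ denotes the length of an interval $J$ and the infimum is over the (possibly finite) set of indices. The thickness of a singleton is defined to be $0$, and the thickness of a non-degenerate interval is defined to be $+\infty$.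
   Formalization: The thickness τ is assumed not to lie strictly between 1 and e, since for τ slightly above 1 the bound N(τ) blows up and the claim fails (middle-α Cantor sets with no 5-term progression); N(1) is taken to be 0 and N(+∞) to be +∞. *)

theory Defs
  imports "HOL-Analysis.Analysis"
begin

definition homothetic_copy :: "real set \<Rightarrow> real set \<Rightarrow> bool" where
  "homothetic_copy B A \<longleftrightarrow> (\<exists>l>0. \<exists>x. B = (\<lambda>a. l * a + x) ` A)"


definition gaps :: "real set \<Rightarrow> real set set" where
  "gaps C = components (convex hull C - C)"

definition gap_index :: "real set \<Rightarrow> nat set" where
  "gap_index C = {n. infinite (gaps C) \<or> n < card (gaps C)}"

definition gap_enumeration :: "real set \<Rightarrow> (nat \<Rightarrow> real set) \<Rightarrow> bool" where
  "gap_enumeration C G \<longleftrightarrow>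
     bij_betw G (gap_index C) (gaps C) \<and>
     (\<forall>m\<in>gap_index C. \<forall>n\<in>gap_index C. m \<le> n \<longrightarrow> measure lborel (G n) \<le> measure lborel (G m))"

definition gap_parent :: "real set \<Rightarrow> (nat \<Rightarrow> real set) \<Rightarrow> nat \<Rightarrow> real set" where
  "gap_parent C G n =
     (THE J. J \<in> components (convex hull C - (\<Union>k<n. G k)) \<and> G n \<subseteq> J)"

definition left_piece :: "real set \<Rightarrow> (nat \<Rightarrow> real set) \<Rightarrow> nat \<Rightarrow> real set" where
  "left_piece C G n = {y \<in> gap_parent C G n - G n. \<forall>g\<in>G n. y < g}"

definition right_piece :: "real set \<Rightarrow> (nat \<Rightarrow> real set) \<Rightarrow> nat \<Rightarrow> real set" where
  "right_piece C G n = {y \<in> gap_parent C G n - G n. \<forall>g\<in>G n. g < y}"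

text \<open>
  The choice of the enumeration only matters for ties between gaps of equal length, which do not
  affect the infimum. For a non-degenerate interval there are no gaps and the infimum over the
  empty index set is \<open>\<infinity>\<close>. The value \<open>0\<close> for singletons is a separate convention,
  extended here to the empty set.
\<close>

definition thickness :: "real set \<Rightarrow> ereal" where
  "thickness C =
     (if \<exists>x. C \<subseteq> {x} then 0
      else (let G = (SOME G. gap_enumeration C G) in
        INF n\<in>gap_index C.
          ereal (min (measure lborel (left_piece C G n)) (measure lborel (right_piece C G n))
                 / measure lborel (G n))))"


text \<open>
  Boundedness is required of the covering sets because \<open>diameter\<close> is meaningless on unbounded
  sets. Only exponents \<open>s > 0\<close> are used below, so empty and one-point covering sets contribute
  \<open>0 powr s = 0\<close>.
\<close>

definition hausdorff_premeasure :: "real \<Rightarrow> real \<Rightarrow> 'a::metric_space set \<Rightarrow> ennreal" where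
  "hausdorff_premeasure s d E =
     (INF U\<in>{U :: nat \<Rightarrow> 'a set. E \<subseteq> (\<Union>i. U i) \<and> (\<forall>i. bounded (U i) \<and> diameter (U i) \<le> d)}.
        \<Sum>i. ennreal (diameter (U i) powr s))"

definition hausdorff_measure :: "real \<Rightarrow> 'a::metric_space set \<Rightarrow> ennreal" where
  "hausdorff_measure s E = (SUP d\<in>{0<..}. hausdorff_premeasure s d E)"

definition hausdorff_dim :: "'a::metric_space set \<Rightarrow> ennreal" where
  "hausdorff_dim E = Inf {ennreal s | s. 0 < s \<and> hausdorff_measure s E = 0}"


text \<open>
  The bound on the number of points; \<open>ln\<close> is the natural logarithm and \<open>\<infinity>\<close> is the limiting
  value as the thickness tends to \<open>\<infinity>\<close>. It is negative for thickness in \<open>(0,1)\<close>, and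
  \<open>0\<close> at \<open>0\<close> and at \<open>1\<close> (where the denominator vanishes and \<open>x / 0 = 0\<close>).
  Pitfall: \<open>t / ln t\<close> is increasing only for \<open>t \<ge> e\<close> and blows up as \<open>t\<close> decreases to \<open>1\<close>,
  so the bound has its intended meaning only outside the range \<open>1 < t < e\<close>.
\<close>

definition pattern_bound :: "ereal \<Rightarrow> ereal" where
  "pattern_bound t =
     (if t = \<infinity> then \<infinity>
      else ereal (of_int
        \<lfloor>ln 4 / (4 * exp 1 * 720\<^sup>2) * (real_of_ereal t / ln (real_of_ereal t))\<rfloor>))"

end

theory Submission
  imports Defs
begin

text \<open>
  Fix a scale \<open>l\<close> so small that the translates \<open>C - l * a\<close>, \<open>a \<in> A\<close>, have a common interval of half the
  length of the convex hull of \<open>C\<close> inside their hulls; a point of this interval which avoids the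
  gaps of all translates is a valid shift. Such a point is found by repeatedly passing to one of the
  four quarters of the current interval \<open>B\<close>, guided by the potential
  \<open>\<Phi>(B) = (\<Sum>G. \<bar>G \<inter> B\<bar> powr c)\<close>, with \<open>c = 1 - 1 / ln \<tau>\<close>, which is kept at most \<open>\<bar>B\<bar> powr c / 4\<close>;
  then no gap ever swallows \<open>B\<close>. A gap is taken into account only once \<open>\<bar>B\<bar> \<le> \<tau> * \<bar>G\<bar>\<close>.
  A gap already present meets at most two quarters, so by concavity some quarter has its normalised old
  potential multiplied by at most \<open>2 powr (c - 1)\<close>, which is about \<open>1 - ln 2 / ln \<tau>\<close>. Gaps of \<open>C\<close> are
  separated by \<open>\<tau>\<close> times the shorter length, so every translate contributes at most one new gap per
  step, of relative length at most \<open>4 / \<tau>\<close>. The gain exceeds the new terms when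
  \<open>card A\<close> is at most a small multiple of \<open>\<tau> / ln \<tau>\<close>.

  For the dimension, any cover of the set of good shifts by finitely many open intervals whose lengths
  have a small sum of \<open>c\<close>-th powers can be added to the gaps as obstacles of the first stage. The point
  found then escapes the cover, so the set of good shifts has positive \<open>c\<close>-dimensional measure.
\<close>

section \<open>Avoiding obstacles\<close>

text \<open>The tangent to \<open>z powr c\<close> at the midpoint lies above the graph, and its
  linear terms at \<open>x\<close> and \<open>y\<close> cancel.\<close>

lemma powr_midpoint_concave:
  fixes x y c :: real
  assumes "0 \<le> x" "0 \<le> y" "0 < c" "c \<le> 1"
  shows "x powr c + y powr c \<le> 2 * ((x + y) / 2) powr c"
proof (cases "x + y = 0")
  case True
  then show ?thesis using assms by (simp add: add_nonneg_eq_0_iff)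
next
  case False
  define m where "m = (x + y) / 2"
  have m: "m > 0" using False assms by (simp add: m_def)
  have tangent: "z powr c \<le> m powr c * (1 + c * (z / m - 1))" if "0 \<le> z" for z
  proof -
    have "(z / m) powr c \<le> 1 + c * (z / m - 1)"
    proof (cases "z = 0")
      case True
      then show ?thesis using assms by simp
    next
      case False
      have "(z / m) powr c * 1 powr (1 - c) \<le> c * (z / m) + (1 - c) * 1"
        using assms m that False by (intro Youngs_inequality_0) auto
      then show ?thesis by (simp add: algebra_simps)
    qed
    then have "m powr c * (z / m) powr c \<le> m powr c * (1 + c * (z / m - 1))"
      by (intro mult_left_mono) auto
    then show ?thesis using m that by (simp add: powr_divide)
  qed
  have "x / m + y / m = (2 * m) / m" by (simp add: m_def add_divide_distrib)
  then have "x / m + y / m = 2" using m by simp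
  moreover have "P * (1 + c * (a - 1)) + P * (1 + c * (b - 1)) = 2 * P" if "a + b = 2" for P a b :: real
  proof -
    have "b = 2 - a" using that by simp
    show ?thesis unfolding \<open>b = 2 - a\<close> by (simp add: algebra_simps)
  qed
  ultimately have "m powr c * (1 + c * (x / m - 1)) + m powr c * (1 + c * (y / m - 1)) = 2 * m powr c"
    by blast
  then show ?thesis using tangent[OF assms(1)] tangent[OF assms(2)] by (simp add: m_def)
qed

text \<open>The length of the intersection of \<open>{u<..<v}\<close> with the window of length
  \<open>l\<close> starting at \<open>p\<close>. The explicit formula lets linear arithmetic replace
  measure theory.\<close>

definition overlap :: "real \<Rightarrow> real \<Rightarrow> real \<Rightarrow> real \<Rightarrow> real" where
  "overlap u v p l = max 0 (min v (p + l) - max u p)"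

lemma overlap_nonneg: "0 \<le> overlap u v p l"
  by (simp add: overlap_def)

lemma overlap_le: "u \<le> v \<Longrightarrow> overlap u v p l \<le> v - u"
  by (auto simp: overlap_def)

lemma overlap_quarters:
  assumes "h > 0" "0 < c" "c \<le> 1" "overlap u v p (4 * h) \<le> h"
  shows "(\<Sum>i<4. overlap u v (p + real i * h) h powr c) \<le> 2 * (overlap u v p (4 * h) / 2) powr c"
proof -
  define f where "f i = overlap u v (p + real i * h) h" for i :: nat
  define s where "s = overlap u v p (4 * h)"
  have sum: "f 0 + f 1 + f 2 + f 3 = s"
    using assms(1) unfolding f_def s_def overlap_def max_def min_def by auto
  \<comment> \<open>an obstacle of length at most \<open>h\<close> meets at most two of the quarters, and these are adjacent\<close>
  have far: "f 0 = 0 \<or> f 2 = 0" "f 0 = 0 \<or> f 3 = 0" "f 1 = 0 \<or> f 3 = 0"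
    using assms(1,4) unfolding f_def overlap_def max_def min_def by (auto split: if_splits)
  have nn: "f i \<ge> 0" for i by (simp add: f_def overlap_nonneg)
  have m: "x powr c + y powr c \<le> 2 * (s / 2) powr c" if "0 \<le> x" "0 \<le> y" "x + y = s" for x y
    using powr_midpoint_concave[OF that(1,2) assms(2,3)] that(3) by simp
  have "f 0 powr c + f 1 powr c + f 2 powr c + f 3 powr c \<le> 2 * (s / 2) powr c"
    using far sum nn m[of "f 0" "f 1"] m[of "f 1" "f 2"] m[of "f 2" "f 3"] assms(2)
    by auto
  then show ?thesis by (simp add: f_def s_def eval_nat_numeral)
qed

text \<open>Averaging: the potentials of the four quarters sum to at most
  \<open>2 * (1/2) powr c * ((4 * h) powr c / 4)\<close>, which is four times the asserted
  bound.\<close>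

lemma avoidance_step:
  fixes u v :: "'i \<Rightarrow> real"
  assumes "finite E" "h > 0" "0 < c" "c \<le> 1"
    and pot: "(\<Sum>j\<in>E. overlap (u j) (v j) p (4 * h) powr c) \<le> (4 * h) powr c / 4"
  shows "\<exists>i<4::nat. (\<Sum>j\<in>E. overlap (u j) (v j) (p + real i * h) h powr c)
           \<le> 2 powr (c - 1) * (h powr c / 4)"
proof (rule ccontr)
  assume "\<not> ?thesis"
  then have bad: "2 powr (c - 1) * (h powr c / 4)
      < (\<Sum>j\<in>E. overlap (u j) (v j) (p + real i * h) h powr c)" if "i < 4" for i
    using that by force
  \<comment> \<open>Here the factor 1/4 in the threshold is used: \<open>(4 * h) powr c / 4\<close>
    is at most \<open>h powr c\<close> because \<open>c \<le> 1\<close>.\<close>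
  have small: "overlap (u j) (v j) p (4 * h) \<le> h" if "j \<in> E" for j
  proof (rule ccontr)
    assume "\<not> ?thesis"
    then have "h powr c < overlap (u j) (v j) p (4 * h) powr c"
      using assms by (intro powr_less_mono2) auto
    also have "\<dots> \<le> (4 * h) powr c / 4"
      using member_le_sum[OF that, of "\<lambda>j. overlap (u j) (v j) p (4 * h) powr c"] pot assms(1) by force
    also have "\<dots> = 4 powr c / 4 * h powr c" using assms by (simp add: powr_mult)
    also have "\<dots> \<le> 4 powr 1 / 4 * h powr c"
      using assms by (intro mult_right_mono divide_right_mono powr_mono) auto
    finally show False by simp
  qed
  have "2 powr (c - 1) * h powr c = (\<Sum>i<4::nat. 2 powr (c - 1) * (h powr c / 4))" by simp
  also have "\<dots> < (\<Sum>i<4::nat. \<Sum>j\<in>E. overlap (u j) (v j) (p + real i * h) h powr c)"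
    using bad by (intro sum_strict_mono) (auto simp: lessThan_empty_iff)
  also have "\<dots> = (\<Sum>j\<in>E. \<Sum>i<4::nat. overlap (u j) (v j) (p + real i * h) h powr c)"
    by (rule sum.swap)
  also have "\<dots> \<le> (\<Sum>j\<in>E. 2 * (overlap (u j) (v j) p (4 * h) / 2) powr c)"
    using overlap_quarters[OF assms(2-4) small] by (intro sum_mono) auto
  also have "\<dots> = 2 * (1/2) powr c * (\<Sum>j\<in>E. overlap (u j) (v j) p (4 * h) powr c)"
    by (simp add: sum_distrib_left powr_divide overlap_nonneg)
  also have "\<dots> \<le> 2 * (1/2) powr c * ((4 * h) powr c / 4)"
    using pot by (intro mult_left_mono) auto
  also have "\<dots> = 2 powr (c - 1) * h powr c"
  proof -
    have "4 powr c = (2 powr c * 2 powr c :: real)" by (simp flip: powr_mult)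
    then show ?thesis using assms by (simp add: powr_mult powr_divide powr_diff)
  qed
  finally show False by simp
qed

text \<open>\<open>E k\<close> holds the obstacles counted at stage \<open>k\<close>. Old obstacles
  use the share \<open>2 powr (c - 1)\<close> of the threshold and new ones the rest, so the
  invariant passes to the next window.\<close>

lemma obstacle_avoidance:
  fixes u v :: "'i \<Rightarrow> real" and E :: "nat \<Rightarrow> 'i set"
  assumes "\<And>k. finite (E k)" "\<And>k. E k \<subseteq> E (Suc k)" "0 < c" "c \<le> 1" "0 < l"
    and initial: "(\<Sum>j\<in>E 0. overlap (u j) (v j) p l powr c) \<le> l powr c / 4"
    and new: "\<And>k q. (\<Sum>j\<in>E (Suc k) - E k. overlap (u j) (v j) q (l / 4 ^ Suc k) powr c)
                \<le> (1 - 2 powr (c - 1)) * ((l / 4 ^ Suc k) powr c / 4)"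
  obtains x where "x \<in> {p..p + l}" "\<And>k j. j \<in> E k \<Longrightarrow> x \<notin> {u j<..<v j}"
proof -
  define h where "h k = l / 4 ^ k" for k
  have h: "h k > 0" "h k = 4 * h (Suc k)" for k using assms(5) by (auto simp: h_def)
  define \<Phi> where "\<Phi> k q = (\<Sum>j\<in>E k. overlap (u j) (v j) q (h k) powr c)" for k q
  have "\<exists>q. \<forall>k. (\<Phi> k (q k) \<le> h k powr c / 4 \<and> (k = 0 \<longrightarrow> q k = p)) \<and>
          (q k \<le> q (Suc k) \<and> q (Suc k) + h (Suc k) \<le> q k + h k)"
  proof (rule dependent_nat_choice)
    show "\<exists>x. \<Phi> 0 x \<le> h 0 powr c / 4 \<and> ((0::nat) = 0 \<longrightarrow> x = p)"
      using initial by (intro exI[of _ p]) (simp add: \<Phi>_def h_def)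
  next
    fix q k assume "\<Phi> k q \<le> h k powr c / 4 \<and> (k = 0 \<longrightarrow> q = p)"
    then have "(\<Sum>j\<in>E k. overlap (u j) (v j) q (4 * h (Suc k)) powr c) \<le> (4 * h (Suc k)) powr c / 4"
      by (simp add: \<Phi>_def h(2)[of k])
    then obtain i :: nat where i: "i < 4"
      and old: "(\<Sum>j\<in>E k. overlap (u j) (v j) (q + real i * h (Suc k)) (h (Suc k)) powr c)
        \<le> 2 powr (c - 1) * (h (Suc k) powr c / 4)"
      using avoidance_step[OF assms(1) h(1) assms(3,4)] by blast
    define q' where "q' = q + real i * h (Suc k)"
    have "\<Phi> (Suc k) q' = (\<Sum>j\<in>E (Suc k) - E k. overlap (u j) (v j) q' (h (Suc k)) powr c)
            + (\<Sum>j\<in>E k. overlap (u j) (v j) q' (h (Suc k)) powr c)"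
      unfolding \<Phi>_def using assms(1,2) by (intro sum.subset_diff) auto
    also have "\<dots> \<le> (1 - 2 powr (c - 1)) * (h (Suc k) powr c / 4)
        + 2 powr (c - 1) * (h (Suc k) powr c / 4)"
      using new[where k = k and q = q'] old unfolding h_def q'_def by (intro add_mono) auto
    also have "\<dots> = h (Suc k) powr c / 4" by (simp only: left_diff_distrib)
    finally have pot': "\<Phi> (Suc k) q' \<le> h (Suc k) powr c / 4" .
    have "real i * h (Suc k) \<le> 3 * h (Suc k)" "0 \<le> real i * h (Suc k)"
      using i h(1)[of "Suc k"] by (auto intro!: mult_right_mono)
    then have "q \<le> q' \<and> q' + h (Suc k) \<le> q + h k" by (simp add: q'_def h(2)[of k])
    with pot' show "\<exists>y. (\<Phi> (Suc k) y \<le> h (Suc k) powr c / 4 \<and> (Suc k = 0 \<longrightarrow> y = p)) \<and>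
        q \<le> y \<and> y + h (Suc k) \<le> q + h k" by blast
  qed
  then obtain q where q: "\<And>k. \<Phi> k (q k) \<le> h k powr c / 4" "q 0 = p"
      "\<And>k. q k \<le> q (Suc k)" "\<And>k. q (Suc k) + h (Suc k) \<le> q k + h k"
    by metis
  have inc: "q k \<le> q m" if "k \<le> m" for k m using lift_Suc_mono_le[of q] q(3) that by blast
  have dec: "q m + h m \<le> q k + h k" if "k \<le> m" for k m
    using lift_Suc_antimono_le[of "\<lambda>k. q k + h k"] q(4) that by blast
  have cross: "q m \<le> q k + h k" for k m
    using inc[of m "max m k"] dec[of k "max m k"] h(1)[of "max m k"] by simp
  \<comment> \<open>The windows are nested, so the supremum of their left ends lies in all of
    them.\<close>
  define x where "x = (SUP k. q k)"
  have lower: "q k \<le> x" for k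
    unfolding x_def using cross by (intro cSUP_upper bdd_aboveI[of _ "q 0 + h 0"]) auto
  have upper: "x \<le> q k + h k" for k
    unfolding x_def using cross by (intro cSUP_least) auto
  have "x \<notin> {u j<..<v j}" if j: "j \<in> E k" for k j
  proof
    assume x: "x \<in> {u j<..<v j}"
    \<comment> \<open>A window that contains \<open>x\<close> and is shorter than \<open>d\<close>
      lies inside the obstacle; this one overlap then exceeds the threshold.\<close>
    define d where "d = min (x - u j) (v j - x)"
    have "d > 0" using x by (simp add: d_def)
    obtain n where n: "l / d < 4 ^ n" using real_arch_pow[of 4 "l / d"] by auto
    define m where "m = max n k"
    have "(4::real) ^ n \<le> 4 ^ m" by (simp add: m_def)
    then have "l / d < 4 ^ m" using n by linarith
    then have hm: "h m < d" using \<open>d > 0\<close> by (simp add: h_def field_simps)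
    have "E k \<subseteq> E m" using lift_Suc_mono_le[of E k m] assms(2) by (simp add: m_def)
    then have jm: "j \<in> E m" using j by auto
    have "overlap (u j) (v j) (q m) (h m) = h m"
      using hm lower[of m] upper[of m] h(1)[of m] by (auto simp: d_def overlap_def)
    then have "h m powr c \<le> \<Phi> m (q m)"
      using member_le_sum[OF jm, of "\<lambda>j. overlap (u j) (v j) (q m) (h m) powr c"] assms(1)
      by (simp add: \<Phi>_def)
    then have "h m powr c \<le> h m powr c / 4" using q(1)[of m] by linarith
    then show False using h(1)[of m] by simp
  qed
  moreover have "x \<in> {p..p + l}" using lower[of 0] upper[of 0] q(2) by (simp add: h_def)
  ultimately show ?thesis using that by blast
qed

section \<open>Hausdorff dimension\<close>

text \<open>If the measure vanished for some \<open>s < c\<close>, a cheap countable cover of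
  \<open>S\<close>, fattened to open intervals, would have a finite subfamily that covers the
  compact \<open>K\<close>, contrary to \<open>uncovered\<close>.\<close>

lemma hausdorff_dim_lower_bound:
  fixes K S :: "real set"
  assumes "compact K" "K \<subseteq> S" "0 < c" "c \<le> 1" "0 < \<delta>"
    and uncovered: "\<And>F. \<lbrakk>finite F; \<And>u v. (u, v) \<in> F \<Longrightarrow> u \<le> v; (\<Sum>(u, v)\<in>F. (v - u) powr c) \<le> \<delta>\<rbrakk>
          \<Longrightarrow> \<exists>x\<in>K. \<forall>(u, v)\<in>F. x \<notin> {u<..<v}"
  shows "ennreal c \<le> hausdorff_dim S"
  unfolding hausdorff_dim_def
proof (rule Inf_greatest, safe)
  fix s :: real assume s: "0 < s" "hausdorff_measure s S = 0"
  show "ennreal c \<le> ennreal s"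
  proof (rule ccontr)
    assume "\<not> ?thesis"
    then have sc: "s < c" using s(1) assms(3) by (auto simp: ennreal_le_iff2 not_le)
    \<comment> \<open>At scale 1 all diameters are at most 1, so passing from exponent
      \<open>s\<close> to the larger \<open>c\<close> does not increase the terms.\<close>
    have "hausdorff_premeasure s 1 S \<le> hausdorff_measure s S"
      unfolding hausdorff_measure_def by (intro SUP_upper) auto
    then have "hausdorff_premeasure s 1 S < ennreal (\<delta> / 8)" using s(2) assms(5) by simp
    then obtain U :: "nat \<Rightarrow> real set" where U: "S \<subseteq> (\<Union>i. U i)"
        "\<And>i. bounded (U i)" "\<And>i. diameter (U i) \<le> 1"
        and total: "(\<Sum>i. ennreal (diameter (U i) powr s)) < ennreal (\<delta> / 8)"
      unfolding hausdorff_premeasure_def INF_less_iff by blast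
    define d where "d i = diameter (U i)" for i
    have d: "0 \<le> d i" "d i \<le> 1" for i
      using U(2,3) by (auto simp: d_def diameter_ge_0)
    \<comment> \<open>For empty \<open>U i\<close> the centre is arbitrary, and the interval around
      it only enlarges the cover.\<close>
    define y where "y i = (SOME y. y \<in> U i)" for i
    have y: "\<bar>z - y i\<bar> \<le> d i" if "z \<in> U i" for z i
      using diameter_bounded_bound[OF U(2) that, of "y i"] that someI[of "\<lambda>y. y \<in> U i" z]
      by (simp add: y_def d_def dist_real_def)
    \<comment> \<open>The \<open>c\<close>-th powers of these enlargements sum to at most
      \<open>\<delta> / 8\<close>. With the factor 4 in \<open>size\<close>, diameters and
      enlargements use half of \<open>\<delta>\<close> each.\<close>
    define e where "e i = (\<delta> / 16 * (1/2) ^ i) powr (1 / c)" for i :: nat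
    have e: "e i > 0" "e i powr c = \<delta> / 16 * (1/2) ^ i" for i
      using assms(3,5) by (auto simp: e_def powr_powr)
    define W where "W i = {y i - (d i + e i)<..<y i + (d i + e i)}" for i
    have "U i \<subseteq> W i" for i
    proof
      fix z assume "z \<in> U i"
      then show "z \<in> W i" using y[of z i] e(1)[of i] by (auto simp: W_def)
    qed
    then have "(\<Union>i. U i) \<subseteq> (\<Union>i. W i)" by (intro UN_mono) auto
    then have "K \<subseteq> (\<Union>i. W i)" using U(1) assms(2) by (meson order_trans)
    then obtain I where I: "finite I" "K \<subseteq> (\<Union>i\<in>I. W i)"
      using compactE_image[OF assms(1), of UNIV W] by (auto simp: W_def)
    define g where "g i = (y i - (d i + e i), y i + (d i + e i))" for i
    have size: "(2 * (d i + e i)) powr c \<le> 4 * (d i powr s) + 4 * (\<delta> / 16 * (1/2) ^ i)" for i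
    proof -
      have "(2 * (d i + e i)) powr c \<le> (4 * max (d i) (e i)) powr c"
        using d(1)[of i] e(1)[of i] assms(3) by (intro powr_mono2) auto
      also have "\<dots> = 4 powr c * max (d i) (e i) powr c"
        using d(1)[of i] by (simp add: powr_mult)
      also have "\<dots> \<le> 4 powr 1 * max (d i) (e i) powr c"
        using assms(4) by (intro mult_right_mono powr_mono) auto
      also have "\<dots> \<le> 4 * (d i powr c) + 4 * (e i powr c)" by (auto simp: max_def)
      also have "d i powr c \<le> d i powr s"
        using d[of i] sc powr_mono'[of s c "d i"] by simp
      finally show ?thesis by (simp only: e(2))
    qed
    have sum_d: "(\<Sum>i\<in>I. d i powr s) \<le> \<delta> / 8"
    proof -
      have "ennreal (\<Sum>i\<in>I. d i powr s) = (\<Sum>i\<in>I. ennreal (d i powr s))"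
        by (simp add: sum_ennreal)
      also have "\<dots> \<le> (\<Sum>i. ennreal (d i powr s))"
        by (intro sum_le_suminf) (auto simp: I)
      finally have "ennreal (\<Sum>i\<in>I. d i powr s) < ennreal (\<delta> / 8)" using total by (simp add: d_def)
      then show ?thesis by (simp add: ennreal_less_iff sum_nonneg)
    qed
    have sum_e: "(\<Sum>i\<in>I. (1/2::real) ^ i) \<le> 2"
      using sum_le_suminf[OF summable_geometric[of "1/2::real"], of I] I(1) suminf_geometric[of "1/2::real"]
      by simp
    have "(\<Sum>(u, v)\<in>g ` I. (v - u) powr c) \<le> (\<Sum>i\<in>I. (\<lambda>(u, v). (v - u) powr c) (g i))"
      using sum_image_le[of I "\<lambda>(u, v). (v - u) powr c" g] I(1) by (simp add: o_def case_prod_unfold)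
    also have "\<dots> = (\<Sum>i\<in>I. (2 * (d i + e i)) powr c)"
      by (intro sum.cong) (auto simp: g_def)
    also have "\<dots> \<le> (\<Sum>i\<in>I. 4 * (d i powr s) + 4 * (\<delta> / 16 * (1/2) ^ i))"
      by (intro sum_mono size)
    also have "\<dots> = 4 * (\<Sum>i\<in>I. d i powr s) + \<delta> / 4 * (\<Sum>i\<in>I. (1/2) ^ i)"
      by (simp add: sum.distrib sum_distrib_left)
    also have "\<dots> \<le> 4 * (\<delta> / 8) + \<delta> / 4 * 2"
      using sum_d sum_e assms(5) by (intro add_mono mult_left_mono) auto
    finally have "(\<Sum>(u, v)\<in>g ` I. (v - u) powr c) \<le> \<delta>" by simp
    moreover have "u \<le> v" if "(u, v) \<in> g ` I" for u v
      using that d(1) less_imp_le[OF e(1)] by (auto simp: g_def intro: add_nonneg_nonneg)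
    ultimately obtain x where x: "x \<in> K" "\<forall>(u, v)\<in>g ` I. x \<notin> {u<..<v}"
      using uncovered[of "g ` I"] I(1) by blast
    then obtain i where "i \<in> I" "x \<in> W i" using I(2) by auto
    then show False using x(2) by (auto simp: g_def W_def)
  qed
qed

section \<open>Thickness and the separation of gaps\<close>

text \<open>Gaps recorded by their endpoints, which belong to \<open>C\<close>; this suits arguments
  about length and order better than components do.\<close>

definition gap_pairs :: "real set \<Rightarrow> (real \<times> real) set" where
  "gap_pairs C = {(u, v). u \<in> C \<and> v \<in> C \<and> u < v \<and> {u<..<v} \<inter> C = {}}"

lemma gap_pairsD:
  assumes "(u, v) \<in> gap_pairs C"
  shows "u \<in> C" "v \<in> C" "u < v" "\<And>x. u < x \<Longrightarrow> x < v \<Longrightarrow> x \<notin> C"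
  using assms by (auto simp: gap_pairs_def)

lemma gap_pairs_disjoint:
  assumes "(u, v) \<in> gap_pairs C" "(u', v') \<in> gap_pairs C" "(u, v) \<noteq> (u', v')"
  shows "v \<le> u' \<or> v' \<le> u"
  using gap_pairsD[OF assms(1)] gap_pairsD[OF assms(2)] assms(3)
  by (metis linorder_neqE_linordered_idom not_le_imp_less)

lemma compact_subset_Inf_Sup:
  fixes C :: "real set"
  assumes "compact C"
  shows "C \<subseteq> {Inf C..Sup C}"
  using assms by (auto intro!: cInf_lower cSup_upper
      simp: bounded_imp_bdd_above bounded_imp_bdd_below compact_imp_bounded)

text \<open>The endpoints are the points of \<open>C\<close> nearest to \<open>x\<close> on either
  side, which exist by compactness.\<close>

lemma gap_pair_around:
  assumes "compact C" "C \<noteq> {}" "x \<in> {Inf C..Sup C}" "x \<notin> C"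
  obtains u v where "(u, v) \<in> gap_pairs C" "u < x" "x < v"
proof -
  have "Inf C \<in> C" "Sup C \<in> C"
    using assms closed_contains_Inf closed_contains_Sup
    by (auto simp: compact_imp_closed bounded_imp_bdd_above bounded_imp_bdd_below compact_imp_bounded)
  then have "C \<inter> {..x} \<noteq> {}" "C \<inter> {x..} \<noteq> {}" using assms(3) by auto
  moreover have "compact (C \<inter> {..x})" "compact (C \<inter> {x..})"
    using assms(1) by (auto intro: compact_Int_closed)
  ultimately obtain u v where u: "u \<in> C \<inter> {..x}" "\<And>y. y \<in> C \<inter> {..x} \<Longrightarrow> y \<le> u"
      and v: "v \<in> C \<inter> {x..}" "\<And>y. y \<in> C \<inter> {x..} \<Longrightarrow> v \<le> y"
    using compact_attains_sup compact_attains_inf by metis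
  have "u \<noteq> x" "v \<noteq> x" using u(1) v(1) assms(4) by auto
  then have lt: "u < x" "x < v" using u(1) v(1) by auto
  have "y \<notin> C" if "u < y" "y < v" for y
    using u(2)[of y] v(2)[of y] that by (cases "y \<le> x") force+
  then have "(u, v) \<in> gap_pairs C" using u(1) v(1) lt by (auto simp: gap_pairs_def)
  with lt show ?thesis using that by blast
qed

text \<open>A connected set properly containing such an interval would contain \<open>u\<close> or
  \<open>v\<close>, which lie in \<open>C\<close>. Conversely, a component meets some such interval,
  and components that share a point coincide.\<close>

lemma gaps_eq_gap_pairs:
  assumes "compact C"
  shows "gaps C = (\<lambda>(u, v). {u<..<v}) ` gap_pairs C"
proof -
  have comp: "{u<..<v} \<in> components (convex hull C - C)" if uv: "(u, v) \<in> gap_pairs C" for u v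
  proof -
    note g = gap_pairsD[OF uv]
    have "u \<in> convex hull C" "v \<in> convex hull C" using g by (auto intro: hull_inc)
    moreover have "connected (convex hull C)" by (simp add: convex_connected)
    ultimately have "{u..v} \<subseteq> convex hull C" by (simp add: connected_contains_Icc)
    then have "{u<..<v} \<subseteq> convex hull C - C" using g by auto
    moreover have "D = {u<..<v}" if D: "{u<..<v} \<subseteq> D" "D \<subseteq> convex hull C - C" "connected D" for D
    proof -
      have "z \<in> {u<..<v}" if "z \<in> D" for z
      proof (rule ccontr)
        assume "z \<notin> {u<..<v}"
        then consider "z \<le> u" | "v \<le> z" by fastforce
        then have "u \<in> D \<or> v \<in> D"
          using connectedD_interval[OF D(3) that, of "(u + v) / 2"]
                connectedD_interval[OF D(3) _ that, of "(u + v) / 2"] D(1) g(3)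
          by cases (auto simp: subset_iff)
        then show False using D(2) g by auto
      qed
      then show ?thesis using D(1) by blast
    qed
    ultimately show ?thesis using g(3) unfolding in_components_maximal by auto
  qed
  show ?thesis
  proof (intro equalityI subsetI)
    fix K assume K: "K \<in> gaps C"
    then obtain x where x: "x \<in> K" using in_components_nonempty by (force simp: gaps_def)
    then have "x \<in> convex hull C" "x \<notin> C"
      using K in_components_subset by (force simp: gaps_def)+
    moreover have "convex hull C \<subseteq> {Inf C..Sup C}"
      using compact_subset_Inf_Sup[OF assms] by (intro hull_minimal) auto
    moreover have "C \<noteq> {}" using calculation(1) by auto
    ultimately obtain u v where uv: "(u, v) \<in> gap_pairs C" "u < x" "x < v"
      using gap_pair_around[OF assms] by blast
    then have "K = {u<..<v}"
      using components_eq[OF K[unfolded gaps_def] comp[OF uv(1)]] x by auto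
    then show "K \<in> (\<lambda>(u, v). {u<..<v}) ` gap_pairs C" using uv(1) by force
  qed (auto simp: gaps_def comp)
qed

lemma measure_gap_pair: "(u, v) \<in> gap_pairs C \<Longrightarrow> measure lborel {u<..<v} = v - u"
  by (simp add: gap_pairs_def)

lemma measure_gap_pos:
  assumes "compact C" "K \<in> gaps C"
  shows "0 < measure lborel K"
proof -
  obtain u v where "(u, v) \<in> gap_pairs C" "K = {u<..<v}"
    using assms(2) unfolding gaps_eq_gap_pairs[OF assms(1)] by auto
  then show ?thesis using gap_pairsD(3) by (simp add: measure_gap_pair)
qed

text \<open>The left ends of disjoint gaps of length at least \<open>\<delta>\<close> are
  \<open>\<delta>\<close> apart, so \<open>\<lfloor>u / \<delta>\<rfloor>\<close> tells them apart
  and takes finitely many values.\<close>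

lemma finite_large_gap_pairs:
  assumes "compact C" "0 < \<delta>"
  shows "finite {(u, v) \<in> gap_pairs C. \<delta> \<le> v - u}" (is "finite ?P")
proof -
  obtain a b where ab: "C \<subseteq> {a..b}" using compact_subset_Inf_Sup[OF assms(1)] by blast
  define f where "f = (\<lambda>(u, v :: real). \<lfloor>u / \<delta>\<rfloor>)"
  have far: "\<lfloor>u / \<delta>\<rfloor> \<noteq> \<lfloor>u' / \<delta>\<rfloor>" if "(u, v) \<in> ?P" "(u', v') \<in> ?P" "v \<le> u'" for u v u' v'
  proof -
    have "u + \<delta> \<le> u'" using that by auto
    then have "(u + \<delta>) / \<delta> \<le> u' / \<delta>" using assms(2) by (intro divide_right_mono) auto
    then have "u / \<delta> + 1 \<le> u' / \<delta>" using assms(2) by (simp add: add_divide_distrib)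
    then show ?thesis by linarith
  qed
  have "inj_on f ?P"
  proof (rule inj_onI, rule ccontr)
    fix x y assume xy: "x \<in> ?P" "y \<in> ?P" "f x = f y" "x \<noteq> y"
    obtain u v u' v' where uv: "x = (u, v)" "y = (u', v')" by (metis surj_pair)
    then have "v \<le> u' \<or> v' \<le> u" using gap_pairs_disjoint[of u v C u' v'] xy by auto
    then show False using far[of u v u' v'] far[of u' v' u v] xy uv by (auto simp: f_def)
  qed
  moreover have "f ` ?P \<subseteq> {\<lfloor>a / \<delta>\<rfloor>..\<lfloor>b / \<delta>\<rfloor>}"
  proof safe
    fix u v assume "(u, v) \<in> gap_pairs C"
    then have "u \<in> {a..b}" using ab gap_pairsD(1) by blast
    then show "f (u, v) \<in> {\<lfloor>a / \<delta>\<rfloor>..\<lfloor>b / \<delta>\<rfloor>}"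
      using assms(2) by (auto simp: f_def intro!: floor_mono divide_right_mono)
  qed
  ultimately show ?thesis using finite_imageD finite_subset by blast
qed

section \<open>Enumeration of the gaps by decreasing length\<close>

text \<open>Every element has finitely many predecessors in the order by decreasing
  \<open>f\<close>; their number is its rank, and the elements are listed by increasing
  rank.\<close>

lemma decreasing_enumeration_exists:
  fixes f :: "'a \<Rightarrow> real"
  assumes pos: "\<And>x. x \<in> X \<Longrightarrow> 0 < f x"
    and fin: "\<And>\<delta>. 0 < \<delta> \<Longrightarrow> finite {x \<in> X. \<delta> \<le> f x}"
  shows "\<exists>G. bij_betw G {n. infinite X \<or> n < card X} X \<and>
    (\<forall>m\<in>{n. infinite X \<or> n < card X}. \<forall>n\<in>{n. infinite X \<or> n < card X}.
       m \<le> n \<longrightarrow> f (G n) \<le> f (G m))"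
proof -
  have "\<exists>n::nat. 1 / real (Suc n) \<le> f x" if "x \<in> X" for x
    using nat_approx_posE[OF pos[OF that]] by (meson less_imp_le)
  then have "X = (\<Union>n::nat. {x \<in> X. 1 / real (Suc n) \<le> f x})" by blast
  moreover have "countable {x \<in> X. 1 / real (Suc n) \<le> f x}" for n
    by (intro countable_finite fin) simp
  then have "countable (\<Union>n::nat. {x \<in> X. 1 / real (Suc n) \<le> f x})"
    by (intro countable_UN) auto
  ultimately have "countable X" by simp
  define t where "t = to_nat_on X"
  have t: "inj_on t X" unfolding t_def using \<open>countable X\<close> by (rule inj_on_to_nat_on)
  \<comment> \<open>the injection \<open>t\<close> breaks ties between equal values of \<open>f\<close>\<close>
  define before where "before x = {y \<in> X. f x < f y \<or> (f y = f x \<and> t y < t x)}" for x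
  have fin_before: "finite (before x)" if "x \<in> X" for x
    by (rule finite_subset[OF _ fin[OF pos[OF that]]]) (auto simp: before_def)
  define rank where "rank x = card (before x)" for x
  have rank_less: "rank y < rank x" if "x \<in> X" "y \<in> before x" for x y
    unfolding rank_def
    by (rule psubset_card_mono[OF fin_before[OF that(1)]]) (use that in \<open>auto simp: before_def\<close>)
  have inj: "inj_on rank X"
  proof (rule inj_onI, rule ccontr)
    fix x y assume xy: "x \<in> X" "y \<in> X" "rank x = rank y" "x \<noteq> y"
    then have "t x \<noteq> t y" using t by (auto dest: inj_onD)
    then have "y \<in> before x \<or> x \<in> before y" using xy by (auto simp: before_def)
    then show False using rank_less[of x y] rank_less[of y x] xy by auto
  qed
  have mono: "f y \<le> f x" if "x \<in> X" "y \<in> X" "rank x \<le> rank y" for x y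
    using rank_less[of x y] that by (force simp: before_def)
  define R where "R = rank ` X"
  define J where "J = {n. infinite X \<or> n < card X}"
  have infR: "infinite R \<longleftrightarrow> infinite X" and cardR: "card R = card X"
    using inj by (auto simp: R_def finite_image_iff card_image)
  \<comment> \<open>\<open>enumerate\<close> lists the ranks increasingly, whether or not they are
    consecutive, in the finite and in the infinite case.\<close>
  have en: "bij_betw (enumerate R) J R"
    using bij_enumerate[of R] finite_bij_enumerate[of R] infR cardR
    by (cases "finite R") (auto simp: J_def lessThan_def)
  have en_mono: "enumerate R m \<le> enumerate R n" if "m \<in> J" "n \<in> J" "m \<le> n" for m n
  proof (cases "m = n")
    case False
    then have "m < n" using that(3) by simp
    moreover have "n < card R" if "finite R"
      using \<open>n \<in> J\<close> that infR cardR by (simp add: J_def)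
    ultimately show ?thesis
      by (meson finite_enumerate_mono enumerate_mono less_imp_le)
  qed simp
  define G where "G = inv_into X rank \<circ> enumerate R"
  have "bij_betw G J X"
    unfolding G_def using en inj by (intro bij_betw_trans[OF en] bij_betw_inv_into)
      (simp add: R_def bij_betw_def)
  moreover have "f (G n) \<le> f (G m)" if mn: "m \<in> J" "n \<in> J" "m \<le> n" for m n
  proof -
    have R: "enumerate R m \<in> R" "enumerate R n \<in> R" using en mn by (auto dest: bij_betwE)
    then have "rank (G m) = enumerate R m" "rank (G n) = enumerate R n" "G m \<in> X" "G n \<in> X"
      by (auto simp: G_def R_def f_inv_into_f inv_into_into)
    then show ?thesis using mono[of "G m" "G n"] en_mono[OF mn] by simp
  qed
  ultimately show ?thesis unfolding J_def by blast
qed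

text \<open>Ensures that the \<open>SOME\<close> in \<open>thickness\<close> selects a genuine
  enumeration.\<close>

lemma gap_enumeration_exists:
  assumes "compact C"
  shows "\<exists>G. gap_enumeration C G"
proof -
  have "finite {K \<in> gaps C. \<delta> \<le> measure lborel K}" if "0 < \<delta>" for \<delta>
  proof (rule finite_subset)
    show "{K \<in> gaps C. \<delta> \<le> measure lborel K} \<subseteq>
        (\<lambda>(u, v). {u<..<v}) ` {(u, v) \<in> gap_pairs C. \<delta> \<le> v - u}"
      by (force simp: gaps_eq_gap_pairs[OF assms] measure_gap_pair)
  qed (use finite_large_gap_pairs[OF assms that] in simp)
  with decreasing_enumeration_exists[of "gaps C" "measure lborel", OF measure_gap_pos[OF assms]]
  show ?thesis unfolding gap_enumeration_def gap_index_def by blast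
qed

section \<open>From thickness to distances between gaps\<close>

text \<open>The \<open>THE\<close> in \<open>gap_parent\<close> is justified since
  \<open>G n\<close> is connected and disjoint from the earlier gaps, hence lies in exactly one
  component.\<close>

lemma gap_parent_properties:
  assumes "gap_enumeration C G" "n \<in> gap_index C"
  shows "connected (gap_parent C G n)" "G n \<subseteq> gap_parent C G n"
    "gap_parent C G n \<inter> (\<Union>k<n. G k) = {}" "gap_parent C G n \<subseteq> convex hull C"
proof -
  have bij: "bij_betw G (gap_index C) (gaps C)" using assms(1) by (simp add: gap_enumeration_def)
  have gap: "G k \<in> components (convex hull C - C)" if "k \<in> gap_index C" for k
    using bij that by (auto simp: gaps_def dest: bij_betwE)
  define S where "S = convex hull C - (\<Union>k<n. G k)"
  have ne: "G n \<noteq> {}" using gap[OF assms(2)] in_components_nonempty by blast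
  have "G n \<inter> G k = {}" if "k < n" for k
  proof -
    have k: "k \<in> gap_index C" using that assms(2) by (auto simp: gap_index_def)
    then have "G n \<noteq> G k"
      using bij that assms(2) by (metis bij_betw_imp_inj_on inj_onD nat_neq_iff)
    then show ?thesis using components_eq[OF gap[OF assms(2)] gap[OF k]] by blast
  qed
  then have sub: "G n \<subseteq> S" using in_components_subset[OF gap[OF assms(2)]] by (auto simp: S_def)
  moreover have "S \<noteq> {}" using sub ne by blast
  ultimately obtain K where K: "K \<in> components S" "G n \<subseteq> K"
    using exists_component_superset in_components_connected[OF gap[OF assms(2)]] by metis
  have "gap_parent C G n = K"
    unfolding gap_parent_def S_def[symmetric]
  proof (rule the_equality)
    show "J = K" if "J \<in> components S \<and> G n \<subseteq> J" for J
      using components_eq[of J S K] that K ne by blast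
  qed (use K in blast)
  then show "connected (gap_parent C G n)" "G n \<subseteq> gap_parent C G n"
    "gap_parent C G n \<inter> (\<Union>k<n. G k) = {}" "gap_parent C G n \<subseteq> convex hull C"
    using K in_components_connected[OF K(1)] in_components_subset[OF K(1)] by (auto simp: S_def)
qed

text \<open>\<open>measure\<close> is 0 on non-measurable sets, so the bound applies to the pieces
  without a study of their measurability.\<close>

lemma measure_subset_Icc:
  assumes "A \<subseteq> {a..b}" "a \<le> b"
  shows "measure lborel A \<le> b - a"
proof (cases "A \<in> sets lborel")
  case True
  then have "measure lborel A \<le> measure lborel {a..b}"
    using assms(1) by (intro measure_mono_fmeasurable) (auto simp: fmeasurable_def emeasure_lborel_Icc_eq)
  then show ?thesis using assms(2) by simp
qed (use assms(2) in \<open>simp add: measure_notin_sets\<close>)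

lemma thickness_le_pieces:
  assumes "compact C" "0 < t" "ereal t \<le> thickness C"
  obtains G where "gap_enumeration C G"
    "\<And>n. n \<in> gap_index C \<Longrightarrow> t * measure lborel (G n) \<le> measure lborel (left_piece C G n)"
    "\<And>n. n \<in> gap_index C \<Longrightarrow> t * measure lborel (G n) \<le> measure lborel (right_piece C G n)"
proof -
  define G where "G = (SOME G. gap_enumeration C G)"
  have G: "gap_enumeration C G"
    unfolding G_def using gap_enumeration_exists[OF assms(1)] by (rule someI_ex)
  have "thickness C \<noteq> 0" using assms(2,3) by auto
  then have th: "thickness C = (INF n\<in>gap_index C.
          ereal (min (measure lborel (left_piece C G n)) (measure lborel (right_piece C G n))
                 / measure lborel (G n)))"
    unfolding thickness_def G_def Let_def by (auto split: if_splits)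
  have "t * measure lborel (G n) \<le>
      min (measure lborel (left_piece C G n)) (measure lborel (right_piece C G n))"
    if n: "n \<in> gap_index C" for n
  proof -
    have "G n \<in> gaps C" using G n by (auto simp: gap_enumeration_def dest: bij_betwE)
    then have pos: "0 < measure lborel (G n)" by (rule measure_gap_pos[OF assms(1)])
    have "thickness C \<le> ereal (min (measure lborel (left_piece C G n))
        (measure lborel (right_piece C G n)) / measure lborel (G n))"
      unfolding th using n by (rule INF_lower)
    then have "t \<le> min (measure lborel (left_piece C G n))
        (measure lborel (right_piece C G n)) / measure lborel (G n)"
      using assms(3) order_trans by fastforce
    then show ?thesis using pos by (simp add: pos_le_divide_eq)
  qed
  then show ?thesis using that[of G] G by simp
qed

text \<open>\<open>a\<close> is a barrier that the parent does not cross: the left end of the hull,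
  or the right end of a gap removed earlier.\<close>

lemma left_piece_subset:
  assumes "G n = {u<..<v}" "u < v"
    and "a \<le> u" "\<And>y. y \<in> gap_parent C G n \<Longrightarrow> y < a \<Longrightarrow> False"
  shows "left_piece C G n \<subseteq> {a..u}"
proof
  fix y assume y: "y \<in> left_piece C G n"
  then have "y < g" if "u < g" "g < v" for g using that assms(1) by (auto simp: left_piece_def)
  then have "y \<le> u" using dense_ge_bounded[OF assms(2)] by (meson less_imp_le)
  then show "y \<in> {a..u}" using y assms(4) by (force simp: left_piece_def)
qed

lemma right_piece_subset:
  assumes "G n = {u<..<v}" "u < v"
    and "v \<le> b" "\<And>y. y \<in> gap_parent C G n \<Longrightarrow> b < y \<Longrightarrow> False"
  shows "right_piece C G n \<subseteq> {v..b}"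
proof
  fix y assume y: "y \<in> right_piece C G n"
  then have "g < y" if "u < g" "g < v" for g using that assms(1) by (auto simp: right_piece_def)
  then have "v \<le> y" using dense_le_bounded[OF assms(2)] by (meson less_imp_le)
  then show "y \<in> {v..b}" using y assms(4) by (force simp: right_piece_def)
qed

lemma gap_pair_index:
  assumes "compact C" "gap_enumeration C G" "(u, v) \<in> gap_pairs C"
  obtains n where "n \<in> gap_index C" "G n = {u<..<v}"
proof -
  have "{u<..<v} \<in> gaps C" using assms(3) by (force simp: gaps_eq_gap_pairs[OF assms(1)])
  then have "{u<..<v} \<in> G ` gap_index C"
    using assms(2) by (simp add: gap_enumeration_def bij_betw_def)
  then show ?thesis using that by auto
qed

text \<open>The parent lies in the hull, so each piece fits between the gap and an end of the
  hull.\<close>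

lemma thickness_hull_distance:
  assumes "compact C" "0 < t" "ereal t \<le> thickness C" "(u, v) \<in> gap_pairs C"
  shows "t * (v - u) \<le> u - Inf C" "t * (v - u) \<le> Sup C - v"
proof -
  obtain G where G: "gap_enumeration C G"
    "\<And>n. n \<in> gap_index C \<Longrightarrow> t * measure lborel (G n) \<le> measure lborel (left_piece C G n)"
    "\<And>n. n \<in> gap_index C \<Longrightarrow> t * measure lborel (G n) \<le> measure lborel (right_piece C G n)"
    using thickness_le_pieces[OF assms(1-3)] by blast
  obtain n where n: "n \<in> gap_index C" "G n = {u<..<v}"
    using gap_pair_index[OF assms(1) G(1) assms(4)] by blast
  note uv = gap_pairsD[OF assms(4)]
  have le: "Inf C \<le> u" "v \<le> Sup C" 
    using subsetD[OF compact_subset_Inf_Sup[OF assms(1)] uv(1)]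
      subsetD[OF compact_subset_Inf_Sup[OF assms(1)] uv(2)] by auto
  have "convex hull C \<subseteq> {Inf C..Sup C}"
    using compact_subset_Inf_Sup[OF assms(1)] by (intro hull_minimal) auto
  then have "gap_parent C G n \<subseteq> {Inf C..Sup C}"
    using gap_parent_properties(4)[OF G(1) n(1)] by blast
  then have "y \<in> {Inf C..Sup C}" if "y \<in> gap_parent C G n" for y using that by blast
  then have "left_piece C G n \<subseteq> {Inf C..u}" "right_piece C G n \<subseteq> {v..Sup C}"
    using left_piece_subset[of G n, OF n(2) uv(3) le(1)] right_piece_subset[of G n, OF n(2) uv(3) le(2)]
    by force+
  then have "measure lborel (left_piece C G n) \<le> u - Inf C"
    "measure lborel (right_piece C G n) \<le> Sup C - v"
    using le by (blast intro: measure_subset_Icc)+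
  then show "t * (v - u) \<le> u - Inf C" "t * (v - u) \<le> Sup C - v"
    using G(2,3)[OF n(1)] n(2) uv(3) by simp_all
qed

text \<open>The parent of the later gap in the enumeration is disjoint from the earlier gap. Its
  piece on that side therefore lies between the two gaps, and has length at least \<open>t\<close>
  times that of the later gap.\<close>

lemma thickness_gap_distance:
  assumes "compact C" "0 < t" "ereal t \<le> thickness C"
    and "(u, v) \<in> gap_pairs C" "(u', v') \<in> gap_pairs C" "v \<le> u'"
  shows "t * min (v - u) (v' - u') \<le> u' - v"
proof -
  obtain G where G: "gap_enumeration C G"
    "\<And>n. n \<in> gap_index C \<Longrightarrow> t * measure lborel (G n) \<le> measure lborel (left_piece C G n)"
    "\<And>n. n \<in> gap_index C \<Longrightarrow> t * measure lborel (G n) \<le> measure lborel (right_piece C G n)"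
    using thickness_le_pieces[OF assms(1-3)] by blast
  note uv = gap_pairsD[OF assms(4)] and uv' = gap_pairsD[OF assms(5)]
  obtain n where n: "n \<in> gap_index C" "G n = {u<..<v}"
    using gap_pair_index[OF assms(1) G(1) assms(4)] by blast
  obtain m where m: "m \<in> gap_index C" "G m = {u'<..<v'}"
    using gap_pair_index[OF assms(1) G(1) assms(5)] by blast
  define c where "c = (u + v) / 2"
  define c' where "c' = (u' + v') / 2"
  have c: "u < c" "c < v" "u' < c'" "c' < v'" using uv(3) uv'(3) by (auto simp: c_def c'_def)
  have "n \<noteq> m" using n(2) m(2) c assms(6) by (metis greaterThanLessThan_iff less_asym le_less_trans)
  then consider "m < n" | "n < m" by linarith
  then show ?thesis
  proof cases
    case 1
    have "False" if y: "y \<in> gap_parent C G n" "u' < y" for y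
    proof -
      obtain z where z: "u' < z" "z < min y v'" using y(2) uv'(3) dense[of u' "min y v'"] by auto
      have "c \<in> gap_parent C G n" using gap_parent_properties(2)[OF G(1) n(1)] n(2) c by auto
      then have "z \<in> gap_parent C G n"
        using connectedD_interval[OF gap_parent_properties(1)[OF G(1) n(1)] _ y(1), of c z] z c assms(6)
        by simp
      moreover have "z \<in> G m" using z m(2) by simp
      ultimately show False using gap_parent_properties(3)[OF G(1) n(1)] 1 by blast
    qed
    then have "right_piece C G n \<subseteq> {v..u'}"
      using right_piece_subset[of G n, OF n(2) uv(3) assms(6)] by blast
    then have "measure lborel (right_piece C G n) \<le> u' - v"
      by (rule measure_subset_Icc[OF _ assms(6)])
    then have "t * (v - u) \<le> u' - v" using G(3)[OF n(1)] n(2) uv(3) by simp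
    moreover have "t * min (v - u) (v' - u') \<le> t * (v - u)"
      using assms(2) by (intro mult_left_mono) auto
    ultimately show ?thesis by linarith
  next
    case 2
    have "False" if y: "y \<in> gap_parent C G m" "y < v" for y
    proof -
      obtain z where z: "max y u < z" "z < v" using y(2) uv(3) dense[of "max y u" v] by auto
      have "c' \<in> gap_parent C G m" using gap_parent_properties(2)[OF G(1) m(1)] m(2) c by auto
      then have "z \<in> gap_parent C G m"
        using connectedD_interval[OF gap_parent_properties(1)[OF G(1) m(1)] y(1), of c' z] z c assms(6)
        by simp
      moreover have "z \<in> G n" using z n(2) by simp
      ultimately show False using gap_parent_properties(3)[OF G(1) m(1)] 2 by blast
    qed
    then have "left_piece C G m \<subseteq> {v..u'}"
      using left_piece_subset[of G m, OF m(2) uv'(3) assms(6)] by blast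
    then have "measure lborel (left_piece C G m) \<le> u' - v"
      by (rule measure_subset_Icc[OF _ assms(6)])
    then have "t * (v' - u') \<le> u' - v" using G(2)[OF m(1)] m(2) uv'(3) by simp
    moreover have "t * min (v - u) (v' - u') \<le> t * (v' - u')"
      using assms(2) by (intro mult_left_mono) auto
    ultimately show ?thesis by linarith
  qed
qed

section \<open>Patterns in thick sets\<close>

text \<open>Gaps of length at least \<open>l / t\<close> are at least \<open>l\<close> apart, so the
  window has positive overlap with at most one of them.\<close>

lemma large_gaps_overlap:
  assumes "compact C" "0 < t" "ereal t \<le> thickness C" "0 < c" "0 < l"
  shows "(\<Sum>(u, v) | (u, v) \<in> gap_pairs C \<and> l / t \<le> v - u \<and> v - u \<le> w.
            overlap (u - s) (v - s) q l powr c) \<le> w powr c"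
proof -
  define X where "X = {(u, v). (u, v) \<in> gap_pairs C \<and> l / t \<le> v - u \<and> v - u \<le> w}"
  define f where "f = (\<lambda>(u, v). overlap (u - s) (v - s) q l powr c)"
  have "finite X"
    by (rule finite_subset[OF _ finite_large_gap_pairs[OF assms(1), of "l / t"]])
      (use assms in \<open>auto simp: X_def\<close>)
  have far: "f (u, v) = 0 \<or> f (u', v') = 0" if "(u, v) \<in> X" "(u', v') \<in> X" "v \<le> u'" for u v u' v'
  proof -
    have "l = t * (l / t)" using assms(2) by simp
    also have "\<dots> \<le> t * min (v - u) (v' - u')"
      using that assms(2) by (intro mult_left_mono) (auto simp: X_def)
    also have "\<dots> \<le> u' - v"
      using thickness_gap_distance[OF assms(1-3)] that by (simp add: X_def)
    finally have "overlap (u - s) (v - s) q l = 0 \<or> overlap (u' - s) (v' - s) q l = 0"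
      by (auto simp: overlap_def)
    then show ?thesis using assms(4) by (auto simp: f_def)
  qed
  have unique: "f x = 0 \<or> f y = 0" if "x \<in> X" "y \<in> X" "x \<noteq> y" for x y
  proof -
    obtain u v u' v' where "x = (u, v)" "y = (u', v')" by (metis surj_pair)
    then show ?thesis
      using gap_pairs_disjoint[of u v C u' v'] that far[of u v u' v'] far[of u' v' u v]
      by (auto simp: X_def)
  qed
  have "sum f X \<le> w powr c"
  proof (cases "\<exists>x\<in>X. f x \<noteq> 0")
    case True
    then obtain u v where x: "(u, v) \<in> X" "f (u, v) \<noteq> 0" by auto
    have "sum f X = sum f {(u, v)}"
      using unique[OF x(1)] x \<open>finite X\<close> by (intro sum.mono_neutral_right) auto
    also have "\<dots> \<le> (v - u) powr c"
      using gap_pairsD(3)[of u v C] x(1) assms(4) overlap_le[of "u - s" "v - s" q l]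
      by (auto simp: f_def X_def overlap_nonneg intro!: powr_mono2)
    also have "\<dots> \<le> w powr c"
      using x(1) gap_pairsD(3)[of u v C] assms(4) by (auto simp: X_def intro!: powr_mono2)
    finally show ?thesis .
  qed simp
  then show ?thesis by (simp add: X_def f_def)
qed

text \<open>\<open>few\<close> is the budget of the avoidance: each translate contributes at most
  one new gap per stage. The cover \<open>F\<close> takes the share \<open>2 powr (c - 1)\<close> of
  the threshold, which is free at the first stage.\<close>

lemma pattern_avoiding_cover:
  fixes C A :: "real set"
  assumes "compact C" "C \<noteq> {}" "0 < t" "ereal t \<le> thickness C" "finite A" "0 < c" "c < 1" "0 < L"
    and few: "real (card A) * (4 / t) powr c \<le> (1 - 2 powr (c - 1)) / 4"
    and inside: "\<And>a. a \<in> A \<Longrightarrow> {l * a + p..l * a + p + L} \<subseteq> {Inf C..Sup C}"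
    and wide: "Sup C - Inf C \<le> 2 * L"
    and cover: "finite F" "\<And>u v. (u, v) \<in> F \<Longrightarrow> u \<le> v"
      "(\<Sum>(u, v)\<in>F. (v - u) powr c) \<le> 2 powr (c - 1) * (L powr c / 4)"
  obtains x where "x \<in> {p..p + L}" "\<And>a. a \<in> A \<Longrightarrow> l * a + x \<in> C"
    "\<And>u v. (u, v) \<in> F \<Longrightarrow> x \<notin> {u<..<v}"
proof -
  define h where "h k = L / 4 ^ k" for k
  have h: "h k > 0" "h k = 4 * h (Suc k)" for k using assms(8) by (auto simp: h_def)
  define P where "P k = {(u, v) \<in> gap_pairs C. h k / t \<le> v - u}" for k
  have finP: "finite (P k)" for k
    unfolding P_def using finite_large_gap_pairs[OF assms(1), of "h k / t"] h(1)[of k] assms(3) by simp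
  \<comment> \<open>at stage \<open>k\<close>: the large gaps of all translates, and the covering intervals from the start\<close>
  define E where "E k = (A \<times> P k) <+> F" for k
  \<comment> \<open>A shift \<open>x\<close> fails for \<open>a\<close> when
    \<open>l * a + x\<close> lies in a gap, so the obstacle is the gap translated by
    \<open>- l * a\<close>.\<close>
  define lo :: "(real \<times> real \<times> real) + (real \<times> real) \<Rightarrow> real"
    where "lo = case_sum (\<lambda>(a, u, v). u - l * a) fst"
  define hi :: "(real \<times> real \<times> real) + (real \<times> real) \<Rightarrow> real"
    where "hi = case_sum (\<lambda>(a, u, v). v - l * a) snd"
  define ov where "ov k q j = overlap (lo j) (hi j) q (h k) powr c" for k q j
  have sum_gaps: "sum (ov k q) (Inl ` (A \<times> Q)) \<le> real (card A) * w powr c"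
    if Q: "Q \<subseteq> {(u, v). (u, v) \<in> gap_pairs C \<and> h k / t \<le> v - u \<and> v - u \<le> w}" for k q Q w
  proof -
    define X where "X = {(u, v). (u, v) \<in> gap_pairs C \<and> h k / t \<le> v - u \<and> v - u \<le> w}"
    have "finite X"
      by (rule finite_subset[OF _ finP[of k]]) (auto simp: X_def P_def)
    have "sum (ov k q) (Inl ` (A \<times> Q)) = (\<Sum>(a, x)\<in>A \<times> Q. ov k q (Inl (a, x)))"
      by (subst sum.reindex) (auto intro!: sum.cong)
    also have "\<dots> = (\<Sum>a\<in>A. \<Sum>x\<in>Q. ov k q (Inl (a, x)))" by (simp add: sum.cartesian_product)
    also have "\<dots> \<le> (\<Sum>a\<in>A. w powr c)"
    proof (rule sum_mono)
      fix a
      have "(\<Sum>x\<in>Q. ov k q (Inl (a, x))) \<le> (\<Sum>x\<in>X. ov k q (Inl (a, x)))"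
        using Q \<open>finite X\<close> by (intro sum_mono2) (auto simp: X_def ov_def)
      also have "\<dots> = (\<Sum>(u, v)\<in>X. overlap (u - l * a) (v - l * a) q (h k) powr c)"
        by (intro sum.cong) (auto simp: ov_def lo_def hi_def)
      also have "\<dots> \<le> w powr c"
        unfolding X_def using large_gaps_overlap[OF assms(1,3,4,6) h(1)] by simp
      finally show "(\<Sum>x\<in>Q. ov k q (Inl (a, x))) \<le> w powr c" .
    qed
    finally show ?thesis by simp
  qed
  have "\<exists>x\<in>{p..p + L}. \<forall>k j. j \<in> E k \<longrightarrow> x \<notin> {lo j<..<hi j}"
  proof (rule obstacle_avoidance[of E c L lo hi p])
    show "finite (E k)" for k using assms(5) cover(1) finP by (simp add: E_def)
    show "E k \<subseteq> E (Suc k)" for k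
    proof -
      have "h (Suc k) / t \<le> h k / t" using h(1)[of "Suc k"] h(2)[of k] assms(3) by (intro divide_right_mono) auto
      then have "P k \<subseteq> P (Suc k)" by (auto simp: P_def)
      then show ?thesis by (auto simp: E_def)
    qed
    show "(\<Sum>j\<in>E 0. overlap (lo j) (hi j) p L powr c) \<le> L powr c / 4"
    proof -
      \<comment> \<open>The distances of a gap to the two hull ends sum to at most
        \<open>2 * L\<close>. With this upper bound the first stage also counts at most one gap per
        translate.\<close>
      have "v - u \<le> L / t" if "(u, v) \<in> gap_pairs C" for u v
      proof -
        have "2 * (t * (v - u)) \<le> (u - Inf C) + (Sup C - v)"
          using thickness_hull_distance[OF assms(1,3,4) that] by simp
        also have "\<dots> \<le> 2 * L" using wide gap_pairsD(3)[OF that] by simp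
        finally show ?thesis using assms(3) by (simp add: field_simps)
      qed
      then have "sum (ov 0 p) (Inl ` (A \<times> P 0)) \<le> real (card A) * (L / t) powr c"
        by (intro sum_gaps) (auto simp: P_def)
      also have "\<dots> \<le> real (card A) * ((4 / t) powr c * L powr c)"
        using assms(3,6,8) by (intro mult_left_mono) (auto simp flip: powr_mult intro!: powr_mono2 divide_right_mono)
      also have "\<dots> \<le> (1 - 2 powr (c - 1)) / 4 * L powr c"
        using mult_right_mono[OF few, of "L powr c"] by (simp add: mult.assoc)
      finally have gaps: "sum (ov 0 p) (Inl ` (A \<times> P 0)) \<le> (1 - 2 powr (c - 1)) / 4 * L powr c" .
      have "sum (ov 0 p) (Inr ` F) = (\<Sum>x\<in>F. ov 0 p (Inr x))" by (subst sum.reindex) auto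
      also have "\<dots> \<le> (\<Sum>(u, v)\<in>F. (v - u) powr c)"
        using cover(2) assms(6)
        by (intro sum_mono) (auto simp: ov_def lo_def hi_def overlap_nonneg intro!: powr_mono2 overlap_le)
      finally have "sum (ov 0 p) (Inr ` F) \<le> 2 powr (c - 1) * (L powr c / 4)" using cover(3) by simp
      with gaps have "sum (ov 0 p) (Inl ` (A \<times> P 0)) + sum (ov 0 p) (Inr ` F) \<le> L powr c / 4"
        by (simp add: left_diff_distrib)
      moreover have "sum (ov 0 p) (E 0) = sum (ov 0 p) (Inl ` (A \<times> P 0)) + sum (ov 0 p) (Inr ` F)"
        unfolding E_def Plus_def using assms(5) finP cover(1) by (intro sum.union_disjoint) auto
      ultimately show ?thesis by (simp add: ov_def h_def)
    qed
    show "(\<Sum>j\<in>E (Suc k) - E k. overlap (lo j) (hi j) q (L / 4 ^ Suc k) powr c)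
        \<le> (1 - 2 powr (c - 1)) * ((L / 4 ^ Suc k) powr c / 4)" for k q
    proof -
      \<comment> \<open>New gaps are shorter than \<open>h k / t\<close>, which is
        \<open>4 * h (Suc k) / t\<close>; this is the origin of \<open>4 / t\<close> in
        \<open>few\<close>.\<close>
      have "E (Suc k) - E k = Inl ` (A \<times> (P (Suc k) - P k))" by (auto simp: E_def)
      then have "sum (ov (Suc k) q) (E (Suc k) - E k) \<le> real (card A) * (h k / t) powr c"
        by (simp only:) (intro sum_gaps, auto simp: P_def)
      also have "(h k / t) powr c = (4 / t) powr c * h (Suc k) powr c"
        using h(1)[of "Suc k"] assms(3) by (simp add: h(2)[of k] flip: powr_mult)
      also have "real (card A) * \<dots> \<le> (1 - 2 powr (c - 1)) / 4 * h (Suc k) powr c"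
        using mult_right_mono[OF few, of "h (Suc k) powr c"] by (simp add: mult.assoc)
      finally show ?thesis by (simp add: ov_def h_def)
    qed
  next
    fix x assume "x \<in> {p..p + L}" "\<And>k j. j \<in> E k \<Longrightarrow> x \<notin> {lo j<..<hi j}"
    then show ?thesis by blast
  qed (use assms(6-8) in auto)
  then obtain x where x: "x \<in> {p..p + L}" "\<And>k j. j \<in> E k \<Longrightarrow> x \<notin> {lo j<..<hi j}" by blast
  have "l * a + x \<in> C" if a: "a \<in> A" for a
  proof (rule ccontr)
    assume "l * a + x \<notin> C"
    moreover have "l * a + x \<in> {Inf C..Sup C}" using inside[OF a] x(1) by auto
    ultimately obtain u v where uv: "(u, v) \<in> gap_pairs C" "u < l * a + x" "l * a + x < v"
      using gap_pair_around[OF assms(1,2)] by blast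
    obtain k where "L / (t * (v - u)) < 4 ^ k" using real_arch_pow[of 4 "L / (t * (v - u))"] by auto
    then have "h k / t \<le> v - u"
      using gap_pairsD(3)[OF uv(1)] assms(3) by (simp add: h_def field_simps)
    then have "Inl (a, u, v) \<in> E k" using uv(1) a by (auto simp: E_def P_def)
    then show False using x(2)[of "Inl (a, u, v)" k] uv by (simp add: lo_def hi_def)
  qed
  moreover have "x \<notin> {u<..<v}" if "(u, v) \<in> F" for u v
    using x(2)[of "Inr (u, v)" 0] that by (auto simp: E_def lo_def hi_def)
  ultimately show ?thesis using that x(1) by blast
qed

text \<open>Serves the empty pattern: the cover itself is the only family of obstacles, present from
  the start.\<close>

lemma interval_not_covered:
  fixes c :: real
  assumes "0 < c" "c \<le> 1" "finite F" "\<And>u v. (u, v) \<in> F \<Longrightarrow> u \<le> v"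
    "(\<Sum>(u, v)\<in>F. (v - u) powr c) \<le> 1 / 4"
  shows "\<exists>x\<in>{0..1}. \<forall>(u, v)\<in>F. x \<notin> {u<..<v}"
proof -
  have "(\<Sum>j\<in>F. overlap (fst j) (snd j) 0 1 powr c) \<le> (\<Sum>(u, v)\<in>F. (v - u) powr c)"
    using assms(1,4) by (intro sum_mono) (auto simp: overlap_nonneg intro!: powr_mono2 overlap_le)
  also note assms(5)
  finally have initial: "(\<Sum>j\<in>F. overlap (fst j) (snd j) 0 1 powr c) \<le> 1 powr c / 4" by simp
  have \<kappa>: "(2::real) powr (c - 1) \<le> 2 powr 0" using assms(2) by (intro powr_mono) auto
  show ?thesis
  proof (rule obstacle_avoidance[of "\<lambda>_. F" c 1 fst snd 0])
    fix x assume "x \<in> {0..0 + 1 :: real}"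
      "\<And>(k :: nat) j. j \<in> F \<Longrightarrow> x \<notin> {fst j<..<snd j}"
    then show ?thesis by (intro bexI[of _ x]) force+
  qed (use assms(1-3) initial \<kappa> in simp_all)
qed

section \<open>Numerical conditions on the number of points\<close>

text \<open>For this \<open>c\<close>, \<open>t powr (- c)\<close> equals \<open>exp 1 / t\<close>,
  so \<open>(4 / t) powr c\<close> is at most \<open>4 * exp 1 / t\<close>, while
  \<open>1 - 2 powr (c - 1)\<close> is at least \<open>ln 2 / (2 * ln t)\<close>. Hence the order
  \<open>t / ln t\<close>.\<close>

lemma few_points_condition:
  fixes t :: real
  assumes "exp 1 \<le> t" "1 \<le> n" "real n \<le> ln 4 / (4 * exp 1 * 720\<^sup>2) * (t / ln t)"
  defines "c \<equiv> 1 - 1 / ln t"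
  shows "1 / 2 \<le> c" "c < 1" "real n * (4 / t) powr c \<le> (1 - 2 powr (c - 1)) / 4"
proof -
  have t0: "0 < t" using assms(1) exp_gt_zero less_le_trans by blast
  have ln1: "1 \<le> ln t" using assms(1) t0 by (simp add: ln_ge_iff)
  have ln4: "0 < ln (4::real)" "ln (4::real) \<le> 3" using ln_le_minus_one[of "4::real"] by auto
  have e: "0 < exp (1::real)" "exp (1::real) \<le> 3" using exp_le by auto
  have n: "real n * (4 * exp 1 * 518400) * ln t \<le> ln 4 * t"
    using assms(3) ln1 e by (simp add: field_simps)
  \<comment> \<open>Since \<open>n\<close> is at least 1, the constant forces \<open>t\<close>
    beyond \<open>exp 2\<close>, which gives \<open>1 / 2 \<le> c\<close>.\<close>
  have "1 * (4 * exp 1 * 518400) * 1 \<le> real n * (4 * exp 1 * 518400) * ln t"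
    using assms(2) ln1 by (intro mult_mono) auto
  also note n
  also have "ln 4 * t \<le> 3 * t" using ln4 t0 by (intro mult_right_mono) auto
  finally have "3 * exp 1 \<le> t" using e(1) by linarith
  moreover have "exp 1 * exp 1 \<le> 3 * exp (1::real)" using e by (intro mult_right_mono) auto
  moreover have "exp 1 * exp 1 = exp (2::real)" by (simp flip: exp_add)
  ultimately have "exp 2 \<le> t" by linarith
  then have ln2: "2 \<le> ln t" using t0 by (simp add: ln_ge_iff)
  then show "1 / 2 \<le> c" "c < 1" by (auto simp: c_def field_simps)
  define x where "x = ln 2 / ln t"
  have "ln (2::real) \<le> 1" using ln_le_minus_one[of "2::real"] by simp
  then have x: "0 \<le> x" "x \<le> 1" using ln2 by (auto simp: x_def divide_le_eq_1)
  \<comment> \<open>Prepares \<open>exp (- x) \<le> 1 - x / 2\<close> for \<open>x\<close> in the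
    unit interval, by way of \<open>1 + x \<le> exp x\<close>.\<close>
  have "1 \<le> (1 + x) * (1 - x / 2)"
  proof -
    have "x * x \<le> x * 1" using x by (intro mult_left_mono) auto
    then show ?thesis by (simp add: algebra_simps)
  qed
  also have "\<dots> \<le> exp x * (1 - x / 2)" using x by (intro mult_right_mono) auto
  finally have "exp (- x) \<le> 1 - x / 2" by (simp add: exp_minus field_simps)
  moreover have "2 powr (c - 1) = exp (- x)" by (simp add: powr_def c_def x_def)
  ultimately have \<kappa>: "x / 2 \<le> 1 - 2 powr (c - 1)" by simp
  have "(4 / t) powr c = exp (ln (4 / t) * c)" using t0 by (simp add: powr_def mult.commute)
  also have "ln (4 / t) * c = ln (4 / t) + (1 - ln 4 / ln t)"
  proof -
    have "ln (4 / t) * c = ln (4 / t) - (ln 4 - ln t) / ln t"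
      using t0 by (simp add: c_def ln_div right_diff_distrib)
    moreover have "(ln 4 - ln t) / ln t = ln 4 / ln t - 1" using ln2 by (simp add: diff_divide_distrib)
    ultimately show ?thesis by simp
  qed
  also have "exp \<dots> \<le> exp (ln (4 / t) + 1)" using ln4 ln2 by simp
  also have "\<dots> = 4 / t * exp 1" using t0 by (simp add: exp_add)
  finally have "real n * (4 / t) powr c \<le> real n * (4 / t * exp 1)" by (intro mult_left_mono) auto
  also have "\<dots> = (real n * (4 * exp 1 * 518400) * ln t) / (518400 * (t * ln t))"
  proof -
    have "t \<noteq> 1" using ln2 by auto
    then show ?thesis using t0 by (simp add: field_simps)
  qed
  also have "\<dots> \<le> (ln 4 * t) / (518400 * (t * ln t))"
  proof -
    have "0 \<le> t * ln t" using t0 ln2 by (intro mult_nonneg_nonneg) linarith+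
    then show ?thesis by (intro divide_right_mono[OF n]) linarith
  qed
  also have "\<dots> = 2 * x / 518400"
  proof -
    have "ln 4 = 2 * ln (2::real)" using ln_realpow[of "2::real" 2] by simp
    then show ?thesis using t0 ln2 by (simp add: x_def field_simps)
  qed
  also have "\<dots> \<le> x / 2 / 4" using x by simp
  also have "\<dots> \<le> (1 - 2 powr (c - 1)) / 4" using \<kappa> by simp
  finally show "real n * (4 / t) powr c \<le> (1 - 2 powr (c - 1)) / 4" .
qed

lemma thickness_nonneg: "0 \<le> thickness C"
  by (auto simp: thickness_def Let_def intro!: INF_greatest)

text \<open>A finite \<open>\<tau>\<close> serves as \<open>t\<close> itself: if it were at most 1,
  the bound would be at most 0. An infinite one is replaced by a large square, since
  \<open>s\<^sup>2 / ln (s\<^sup>2)\<close> is at least \<open>s / 2\<close>.\<close>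

lemma pattern_bound_witness:
  assumes "0 \<le> \<tau>" "\<not> (1 < \<tau> \<and> \<tau> < ereal (exp 1))" "1 \<le> n" "ereal (real n) \<le> pattern_bound \<tau>"
  obtains t where "exp 1 \<le> t" "ereal t \<le> \<tau>"
    "real n \<le> ln 4 / (4 * exp 1 * 720\<^sup>2) * (t / ln t)"
proof (cases \<tau>)
  case (real r)
  have r0: "0 \<le> r" using assms(1) real by simp
  have K: "0 < ln 4 / (4 * exp 1 * 720\<^sup>2 :: real)" by simp
  have bound: "real n \<le> ln 4 / (4 * exp 1 * 720\<^sup>2) * (r / ln r)"
    using assms(4) real by (simp add: pattern_bound_def) linarith
  have "\<not> r \<le> 1"
  proof
    assume "r \<le> 1"
    then have "ln r \<le> 0" using r0 by (cases "r = 0") auto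
    then have "r / ln r \<le> 0" using r0 by (simp add: divide_nonneg_nonpos)
    then have "ln 4 / (4 * exp 1 * 720\<^sup>2) * (r / ln r) \<le> 0"
      using K by (intro mult_nonneg_nonpos) auto
    then show False using bound assms(3) by simp
  qed
  then have "exp 1 \<le> r" using assms(2) real by auto
  then show ?thesis using that[of r] bound real by simp
next
  case PInf
  define K where "K = ln 4 / (4 * exp 1 * 720\<^sup>2 :: real)"
  have K: "0 < K" by (simp add: K_def)
  \<comment> \<open>The value 3 gives \<open>exp 1 \<le> s\<^sup>2\<close> and a positive
    \<open>ln s\<close>; the other gives \<open>real n \<le> K * (s / 2)\<close>.\<close>
  define s where "s = max 3 (2 * real n / K)"
  have s: "3 \<le> s" "2 * real n / K \<le> s" by (auto simp: s_def)
  have "exp 1 \<le> (3::real)" by (rule exp_le)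
  also have "3 * 1 \<le> s * s" using s by (intro mult_mono) auto
  finally have 1: "exp 1 \<le> s\<^sup>2" by (simp add: power2_eq_square)
  have ln: "ln (s\<^sup>2) = 2 * ln s" using s ln_realpow[of s 2] by simp
  have "0 < ln s" using s by simp
  have "ln s \<le> s" using ln_le_minus_one[of s] s by linarith
  then have "s / 2 * (2 * ln s) \<le> s\<^sup>2" using s by (simp add: power2_eq_square)
  then have "s / 2 \<le> s\<^sup>2 / ln (s\<^sup>2)" using \<open>0 < ln s\<close> by (simp add: ln pos_le_divide_eq)
  then have "K * (s / 2) \<le> K * (s\<^sup>2 / ln (s\<^sup>2))" using K by (intro mult_left_mono) auto
  moreover have "real n \<le> K * (s / 2)" using s(2) K by (simp add: field_simps)
  ultimately show ?thesis using that[of "s\<^sup>2"] 1 PInf by (simp add: K_def)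
qed (use assms(1) in auto)

lemma thick_set_contains_patterns:
  fixes C A :: "real set"
  assumes "compact C" "finite A" "A \<noteq> {}" "exp 1 \<le> t" "ereal t \<le> thickness C"
    "real (card A) \<le> ln 4 / (4 * exp 1 * 720\<^sup>2) * (t / ln t)"
  obtains l x where "0 < l" "(\<lambda>a. l * a + x) ` A \<subseteq> C"
    "0 < hausdorff_dim {x. (\<lambda>a. l * a + x) ` A \<subseteq> C}"
proof -
  have t0: "0 < t" using assms(4) exp_gt_zero less_le_trans by blast
  have "thickness C \<noteq> 0" using assms(5) t0 by auto
  then have large: "\<not> (\<exists>x. C \<subseteq> {x})" unfolding thickness_def by meson
  then have "C \<noteq> {}" by auto
  define D where "D = Sup C - Inf C"
  have D: "0 < D"
  proof (rule ccontr)
    assume "\<not> 0 < D"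
    then have "{Inf C..Sup C} \<subseteq> {Inf C}" by (auto simp: D_def)
    then show False using compact_subset_Inf_Sup[OF assms(1)] large by blast
  qed
  obtain M where M: "0 < M" "\<And>a. a \<in> A \<Longrightarrow> \<bar>a\<bar> \<le> M"
    using finite_imp_bounded[OF assms(2)] by (auto simp: bounded_pos)
  \<comment> \<open>At this scale every \<open>l * a\<close> has modulus at most
    \<open>D / 4\<close>, so the middle half of the hull, from \<open>p\<close> to
    \<open>p + L\<close>, stays inside the hull when translated.\<close>
  define l where "l = D / (4 * M)"
  define p where "p = Inf C + D / 4"
  define L where "L = D / 2"
  have l: "0 < l" and L: "0 < L" using D M(1) by (auto simp: l_def L_def)
  have "{l * a + p..l * a + p + L} \<subseteq> {Inf C..Sup C}" if "a \<in> A" for a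
  proof -
    have "\<bar>l * a\<bar> \<le> l * M" using M(2)[OF that] l by (simp add: abs_mult)
    also have "\<dots> = D / 4" using M(1) by (simp add: l_def)
    finally have "\<bar>l * a\<bar> \<le> D / 4" .
    then have "- (D / 4) \<le> l * a" "l * a \<le> D / 4" by linarith+
    then have "Inf C \<le> l * a + p" "l * a + p + L \<le> Sup C"
      unfolding p_def L_def D_def by (simp_all add: field_simps)
    then show ?thesis by auto
  qed
  note inside = this
  define c where "c = 1 - 1 / ln t"
  have c: "1 / 2 \<le> c" "c < 1" "real (card A) * (4 / t) powr c \<le> (1 - 2 powr (c - 1)) / 4"
    using few_points_condition[OF assms(4) _ assms(6)] assms(2,3)
    by (auto simp: c_def Suc_le_eq card_gt_0_iff)
  then have c0: "0 < c" by simp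
  define K where "K = {p..p + L} \<inter> (\<Inter>a\<in>A. (\<lambda>x. l * a + x) -` C)"
  define \<delta> where "\<delta> = 2 powr (c - 1) * (L powr c / 4)"
  have \<delta>: "0 < \<delta>" using L by (simp add: \<delta>_def)
  have "compact K"
    unfolding K_def using compact_imp_closed[OF assms(1)]
    by (intro compact_Int_closed closed_INT ballI closed_vimage continuous_intros) auto
  have uncovered: "\<exists>x\<in>K. \<forall>(u, v)\<in>F. x \<notin> {u<..<v}"
    if F: "finite F" "\<And>u v. (u, v) \<in> F \<Longrightarrow> u \<le> v" "(\<Sum>(u, v)\<in>F. (v - u) powr c) \<le> \<delta>" for F
  proof -
    obtain x where "x \<in> {p..p + L}" "\<And>a. a \<in> A \<Longrightarrow> l * a + x \<in> C"
        "\<And>u v. (u, v) \<in> F \<Longrightarrow> x \<notin> {u<..<v}"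
      using pattern_avoiding_cover[OF assms(1) \<open>C \<noteq> {}\<close> t0 assms(5,2) c0 c(2) L c(3) inside _ F[unfolded \<delta>_def]]
      by (auto simp: L_def D_def)
    then show ?thesis by (intro bexI[of _ x]) (auto simp: K_def)
  qed
  have KS: "K \<subseteq> {x. (\<lambda>a. l * a + x) ` A \<subseteq> C}" by (auto simp: K_def)
  \<comment> \<open>The empty cover yields an actual shift.\<close>
  obtain x where "x \<in> K" using uncovered[of "{}"] \<delta> by auto
  moreover have "ennreal c \<le> hausdorff_dim {x. (\<lambda>a. l * a + x) ` A \<subseteq> C}"
    using hausdorff_dim_lower_bound[OF \<open>compact K\<close> KS c0 _ \<delta>] c(2) uncovered by simp
  moreover have "0 < ennreal c" using c0 by simp
  ultimately show ?thesis using that[OF l] KS less_le_trans by blast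
qed

theorem theorem4:
  fixes C :: "real set" and \<tau> :: ereal
  assumes "compact C"
    and "\<tau> = thickness C"
    and "\<not> (1 < \<tau> \<and> \<tau> < ereal (exp 1))"
  shows "\<forall>A :: real set. finite A \<and> ereal (real (card A)) \<le> pattern_bound \<tau> \<longrightarrow>
           (\<exists>B. homothetic_copy B A \<and> B \<subseteq> C) \<and>
           (\<exists>l>0. hausdorff_dim {x. (\<lambda>a. l * a + x) ` A \<subseteq> C} > 0)"
proof (intro allI impI)
  fix A :: "real set"
  assume A: "finite A \<and> ereal (real (card A)) \<le> pattern_bound \<tau>"
  show "(\<exists>B. homothetic_copy B A \<and> B \<subseteq> C) \<and>
      (\<exists>l>0. hausdorff_dim {x. (\<lambda>a. l * a + x) ` A \<subseteq> C} > 0)"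
  proof (cases "A = {}")
    case True
    \<comment> \<open>For the empty pattern every shift is good, so positive dimension of the line
      itself is required.\<close>
    have "ennreal 1 \<le> hausdorff_dim (UNIV :: real set)"
      by (rule hausdorff_dim_lower_bound[of "{0..1}" _ _ "1/4"])
        (use interval_not_covered[of 1] in simp_all)
    then have "0 < hausdorff_dim (UNIV :: real set)" by (rule less_le_trans[rotated]) simp
    then show ?thesis
      using True by (auto simp: homothetic_copy_def intro: exI[of _ 1])
  next
    case False
    then have "1 \<le> card A" using A by (simp add: Suc_le_eq card_gt_0_iff)
    then obtain t where t: "exp 1 \<le> t" "ereal t \<le> thickness C"
        "real (card A) \<le> ln 4 / (4 * exp 1 * 720\<^sup>2) * (t / ln t)"
      using pattern_bound_witness[OF thickness_nonneg, of C] A assms(2,3) by metis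
    then obtain l x where lx: "0 < l" "(\<lambda>a. l * a + x) ` A \<subseteq> C"
        "0 < hausdorff_dim {x. (\<lambda>a. l * a + x) ` A \<subseteq> C}"
      using thick_set_contains_patterns[OF assms(1) _ False] A by metis
    then show ?thesis unfolding homothetic_copy_def by blast
  qed
qed

end
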